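(* Let $M = (C_1,\dotsc,C_n)$ be an MCS and $C_k$ be a context in $M$. Then $\pi \in C_k.\mathrm{DSD}(\emptyset)$ iff $\pi$ is a partial symmetry of $M$ w.r.t. $\mathrm{IC}(k)$.
   Context: A multi-context system (MCS) $M = (C_1,\dots,C_n)$ consists of contexts $C_i = (L_i, kb_i, br_i)$ with logic $L_i$ over alphabet $\mathcal{A}_i$ (pairwise disjoint, $\mathcal{A} = \bigcup_i \mathcal{A}_i$), knowledge base $kb_i$ and bridge rules $br_i$ of the form $a \leftarrow (c_1:b_1),\dots,(c_j:b_j), \mathit{not}\,(c_{j+1}:b_{j+1}),\dots,\mathit{not}\,(c_m:b_m)$; $\mathrm{at}(br_i)$ is the set of atoms occurring in $br_i$. The import neighbourhood of $C_k$ is $\mathrm{In}(k) = \{c \mid (c:b) \text{ occurs in the body of some } r \in br_k\}$, and the import closure $\mathrm{IC}(k)$ is the smallest set $S$ of contexts with $C_k \in S$ and, whenever $C_i \in S$, $\{C_j \mid j \in \mathrm{In}(i)\} \subseteq S$. A permutation $\pi$ of $S \subseteq \mathcal{A}$ is a partial symmetry of $M$ w.r.t. a set of contexts $C$ iff for each $C_i \in C$: $\mathcal{A}_i \cup \mathrm{at}(br_i) \subseteq S$, $\mathcal{A}_i^\pi = \mathcal{A}_i$, $kb_i^\pi = kb_i$, $br_i^\pi = br_i$. The join $\pi \bowtie \sigma$ combines two partial symmetries into one permutation agreeing with both (defined only if they agree on common domain elements), and $\Pi \bowtie \Sigma = \{\pi \bowtie \sigma \mid \pi \in \Pi, \sigma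 \in \Sigma\}$. The distributed algorithm $\mathrm{DSD}(H)$ run at context $C_k$ with history $H$ (set of visited contexts): if its cache $c(k)$ is uninitialised, set $c(k) \leftarrow \mathrm{LSD}(C_k)$, where the primitive $\mathrm{LSD}(C_k)$ computes all partial symmetries of $M$ w.r.t. $\{C_k\}$ over $\mathcal{A}_k \cup \mathrm{at}(br_k)$; set $H \leftarrow H \cup \{k\}$, $\Pi \leftarrow c(k)$; for each $i \in \mathrm{In}(k) \setminus H$, set $\Pi \leftarrow \Pi \bowtie C_i.\mathrm{DSD}(H)$ (a request sent to context $C_i$); return $\Pi$.
   Formalization: Partial symmetries w.r.t. IC(k) are taken only over the domain S equal to the union of A_i ∪ at(br_i) for C_i in IC(k); over a larger S the "if" direction is false, since DSD returns only permutations of this S. *)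

theory Defs
  imports Main "HOL-Library.FSet"
begin

text \<open>
  Contexts are addressed by their positions \<open>0, \<dots>, n - 1\<close> in the list \<open>M\<close>, and sets of contexts
  are sets of such positions.

  A logic is abstract, so it carries its own operation \<open>ren f kb\<close> that replaces every atom \<open>a\<close> in
  the knowledge base \<open>kb\<close> by \<open>f a\<close>.  It only has to be meaningful for permutations of the alphabet.
\<close>

record ('a, 'kb) mcs_logic =
  alphabet :: "'a set"
  KB :: "'kb set"
  BS :: "'a set set"
  ACC :: "'kb \<Rightarrow> 'a set set"
  ren :: "('a \<Rightarrow> 'a) \<Rightarrow> 'kb \<Rightarrow> 'kb"

definition is_logic :: "('a, 'kb) mcs_logic \<Rightarrow> bool" where
  "is_logic L \<longleftrightarrow>
     BS L \<subseteq> Pow (alphabet L) \<and>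
     (\<forall>kb \<in> KB L.
        ACC L kb \<subseteq> BS L \<and>
        ren L id kb = kb \<and>
        (\<forall>f g. bij_betw f (alphabet L) (alphabet L) \<and> bij_betw g (alphabet L) (alphabet L) \<longrightarrow>
           ren L (f \<circ> g) kb = ren L f (ren L g kb) \<and>
           ((\<forall>a \<in> alphabet L. f a = g a) \<longrightarrow> ren L f kb = ren L g kb)))"

text \<open>
  A rule \<open>Rule a P N\<close> has head \<open>a\<close>; an element \<open>(c, b)\<close> of \<open>P\<close> stands for the body literal \<open>(c:b)\<close>,
  an element of \<open>N\<close> for \<open>not (c:b)\<close>.  The functions \<open>map_bridge_rule\<close> and \<open>set_bridge_rule\<close>
  generated here rename, respectively collect, all atoms of a rule, leaving context indices alone.
\<close>

datatype 'a bridge_rule =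
  Rule (head: 'a) (pos: "(nat \<times> 'a) fset") (neg: "(nat \<times> 'a) fset")

definition body :: "'a bridge_rule \<Rightarrow> (nat \<times> 'a) set" where
  "body r = fset (pos r) \<union> fset (neg r)"

record ('a, 'kb) ctx =
  logic_of :: "('a, 'kb) mcs_logic"
  kb_of :: "'kb"
  br_of :: "'a bridge_rule set"

type_synonym ('a, 'kb) mcs = "('a, 'kb) ctx list"

abbreviation alph :: "('a, 'kb) mcs \<Rightarrow> nat \<Rightarrow> 'a set" where
  "alph M i \<equiv> alphabet (logic_of (M ! i))"

abbreviation kb :: "('a, 'kb) mcs \<Rightarrow> nat \<Rightarrow> 'kb" where
  "kb M i \<equiv> kb_of (M ! i)"

abbreviation br :: "('a, 'kb) mcs \<Rightarrow> nat \<Rightarrow> 'a bridge_rule set" where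
  "br M i \<equiv> br_of (M ! i)"

definition is_mcs :: "('a, 'kb) mcs \<Rightarrow> bool" where
  "is_mcs M \<longleftrightarrow>
     (\<forall>i < length M. \<forall>j < length M. i \<noteq> j \<longrightarrow> alph M i \<inter> alph M j = {}) \<and>
     (\<forall>i < length M.
        is_logic (logic_of (M ! i)) \<and>
        kb M i \<in> KB (logic_of (M ! i)) \<and>
        (\<forall>r \<in> br M i. head r \<in> alph M i \<and>
           (\<forall>(c, b) \<in> body r. c < length M \<and> b \<in> alph M c)))"

definition full_alphabet :: "('a, 'kb) mcs \<Rightarrow> 'a set" where
  "full_alphabet M = (\<Union>i < length M. alph M i)"

definition at :: "'a bridge_rule set \<Rightarrow> 'a set" where
  "at R = (\<Union>r \<in> R. set_bridge_rule r)"

definition import_nbh :: "('a, 'kb) mcs \<Rightarrow> nat \<Rightarrow> nat set" where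
  "import_nbh M k = {c. \<exists>r \<in> br M k. \<exists>b. (c, b) \<in> body r}"

inductive_set import_closure :: "('a, 'kb) mcs \<Rightarrow> nat \<Rightarrow> nat set"
  for M :: "('a, 'kb) mcs" and k :: nat where
  self: "k \<in> import_closure M k"
| step: "i \<in> import_closure M k \<Longrightarrow> j \<in> import_nbh M i \<Longrightarrow> j \<in> import_closure M k"

text \<open>
  A permutation of \<open>S\<close> is a partial map with domain \<open>S\<close>, so that it determines \<open>S\<close>.
\<close>

definition permutation_of :: "'a set \<Rightarrow> ('a \<rightharpoonup> 'a) \<Rightarrow> bool" where
  "permutation_of S \<pi> \<longleftrightarrow> dom \<pi> = S \<and> bij_betw (the \<circ> \<pi>) S S"

definition partial_symmetry ::
    "('a, 'kb) mcs \<Rightarrow> 'a set \<Rightarrow> nat set \<Rightarrow> ('a \<rightharpoonup> 'a) \<Rightarrow> bool" where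
  "partial_symmetry M S Cs \<pi> \<longleftrightarrow>
     S \<subseteq> full_alphabet M \<and> permutation_of S \<pi> \<and>
     (\<forall>i \<in> Cs.
        alph M i \<union> at (br M i) \<subseteq> S \<and>
        (the \<circ> \<pi>) ` alph M i = alph M i \<and>
        ren (logic_of (M ! i)) (the \<circ> \<pi>) (kb M i) = kb M i \<and>
        map_bridge_rule (the \<circ> \<pi>) ` br M i = br M i)"

definition agree :: "('a \<rightharpoonup> 'a) \<Rightarrow> ('a \<rightharpoonup> 'a) \<Rightarrow> bool" where
  "agree \<pi> \<sigma> \<longleftrightarrow> (\<forall>a \<in> dom \<pi> \<inter> dom \<sigma>. \<pi> a = \<sigma> a)"

text \<open>Under \<open>agree \<pi> \<sigma>\<close>, the map \<open>\<pi> ++ \<sigma>\<close> is the union of the graphs of \<open>\<pi>\<close> and \<open>\<sigma>\<close>.\<close>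

definition join_sets :: "('a \<rightharpoonup> 'a) set \<Rightarrow> ('a \<rightharpoonup> 'a) set \<Rightarrow> ('a \<rightharpoonup> 'a) set"
    (infixl "\<bowtie>" 65) where
  "\<Pi> \<bowtie> \<Sigma> = {\<pi> ++ \<sigma> | \<pi> \<sigma>. \<pi> \<in> \<Pi> \<and> \<sigma> \<in> \<Sigma> \<and> agree \<pi> \<sigma>}"

definition LSD :: "('a, 'kb) mcs \<Rightarrow> nat \<Rightarrow> ('a \<rightharpoonup> 'a) set" where
  "LSD M k = {\<pi>. partial_symmetry M (alph M k \<union> at (br M k)) {k} \<pi>}"

text \<open>
  The algorithm as a big-step semantics.  \<open>DSD M k H c \<Pi> c'\<close>: a call at context \<open>k\<close> with history
  \<open>H\<close>, started with caches \<open>c\<close>, terminates, returns \<open>\<Pi>\<close> and leaves caches \<open>c'\<close>.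
  \<open>DSD_loop M H is \<Pi> c \<Pi>' c'\<close>: the loop over the neighbours \<open>is\<close>, started with value \<open>\<Pi>\<close> of the
  accumulator, ends with value \<open>\<Pi>'\<close>.  Any order of the neighbours is allowed.
\<close>

type_synonym 'a cache = "nat \<rightharpoonup> ('a \<rightharpoonup> 'a) set"

inductive DSD ::
    "('a, 'kb) mcs \<Rightarrow> nat \<Rightarrow> nat set \<Rightarrow> 'a cache \<Rightarrow> ('a \<rightharpoonup> 'a) set \<Rightarrow> 'a cache \<Rightarrow> bool"
  and DSD_loop ::
    "('a, 'kb) mcs \<Rightarrow> nat set \<Rightarrow> nat list \<Rightarrow> ('a \<rightharpoonup> 'a) set \<Rightarrow> 'a cache \<Rightarrow>
       ('a \<rightharpoonup> 'a) set \<Rightarrow> 'a cache \<Rightarrow> bool"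
  for M :: "('a, 'kb) mcs" where
  call:
    "\<lbrakk> c\<^sub>1 = (if c k = None then c(k \<mapsto> LSD M k) else c);
       H\<^sub>1 = H \<union> {k};
       set is = import_nbh M k - H\<^sub>1; distinct is;
       DSD_loop M H\<^sub>1 is (the (c\<^sub>1 k)) c\<^sub>1 \<Pi> c\<^sub>2 \<rbrakk>
     \<Longrightarrow> DSD M k H c \<Pi> c\<^sub>2"
| loop_done:
    "DSD_loop M H [] \<Pi> c \<Pi> c"
| loop_step:
    "\<lbrakk> DSD M i H c \<Sigma> c\<^sub>1; DSD_loop M H is (\<Pi> \<bowtie> \<Sigma>) c\<^sub>1 \<Pi>' c\<^sub>2 \<rbrakk>
     \<Longrightarrow> DSD_loop M H (i # is) \<Pi> c \<Pi>' c\<^sub>2"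

text \<open>
  A cache entry is either uninitialised or was written by an earlier call.
\<close>

definition valid_cache :: "('a, 'kb) mcs \<Rightarrow> 'a cache \<Rightarrow> bool" where
  "valid_cache M c \<longleftrightarrow> (\<forall>j. c j = None \<or> c j = Some (LSD M j))"

end

theory Submission
  imports Defs
begin

text \<open>
  The result of a call at \<open>k\<close> with history \<open>H\<close> is the set of all maps that arise by gluing local
  symmetries of the contexts reachable from \<open>k\<close> outside \<open>H\<close>.  For infinite alphabets such an
  intermediate map need not be injective: two permutations that agree on the common part of their
  domains may map points of their private parts to the same atom.  If the set of contexts is closed
  under imports, however, the glued domain is the disjoint union of the alphabets involved.  Each
  of these is permuted by its local symmetry, so the glued map is a permutation.
\<close>

section \<open>Gluing local symmetries along sets of contexts\<close>

definition local_atoms :: "('a, 'kb) mcs \<Rightarrow> nat \<Rightarrow> 'a set" where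
  "local_atoms M i = alph M i \<union> at (br M i)"

definition glued :: "('a, 'kb) mcs \<Rightarrow> nat set \<Rightarrow> ('a \<rightharpoonup> 'a) set" where
  "glued M V = {\<pi>. dom \<pi> = (\<Union>i\<in>V. local_atoms M i) \<and> (\<forall>i\<in>V. \<pi> |` local_atoms M i \<in> LSD M i)}"

lemma dom_LSD: "\<pi> \<in> LSD M i \<Longrightarrow> dom \<pi> = local_atoms M i"
  by (auto simp: LSD_def partial_symmetry_def permutation_of_def local_atoms_def)

lemma restrict_map_dom: "dom \<pi> \<subseteq> S \<Longrightarrow> \<pi> |` S = \<pi>"
  by (metis domIff in_mono restrict_in restrict_out ext)

lemma glued_singleton: "glued M {k} = LSD M k"
  using dom_LSD[of _ M k] by (fastforce simp: glued_def restrict_map_dom)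

text \<open>\<open>++\<close> gives precedence to its right argument, so only the left restriction
  depends on agreement.\<close>

lemma restrict_add_left:
  assumes "agree \<pi> \<sigma>" "S \<subseteq> dom \<pi>"
  shows "(\<pi> ++ \<sigma>) |` S = \<pi> |` S"
proof
  fix x
  have "\<sigma> x = None \<or> \<sigma> x = \<pi> x" if "x \<in> S"
    using assms that unfolding agree_def by (metis IntI domIff in_mono)
  then show "((\<pi> ++ \<sigma>) |` S) x = (\<pi> |` S) x"
    by (cases "x \<in> S") (auto simp: map_add_def split: option.split)
qed

lemma restrict_add_right:
  assumes "S \<subseteq> dom \<sigma>"
  shows "(\<pi> ++ \<sigma>) |` S = \<sigma> |` S"
  using assms by (auto simp: restrict_map_def map_add_def fun_eq_iff split: option.splits)

text \<open>Membership in \<open>glued\<close> is a condition on each context separately, so a join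
  merely accumulates conditions. Since \<open>V\<close> and \<open>W\<close> may overlap, a context
  visited along several branches does no harm.\<close>

lemma glued_join: "glued M V \<bowtie> glued M W = glued M (V \<union> W)"
proof (intro set_eqI iffI)
  fix \<rho> assume "\<rho> \<in> glued M V \<bowtie> glued M W"
  then obtain \<pi> \<sigma> where \<rho>: "\<rho> = \<pi> ++ \<sigma>" and \<pi>: "\<pi> \<in> glued M V" and \<sigma>: "\<sigma> \<in> glued M W"
    and ag: "agree \<pi> \<sigma>"
    by (auto simp: join_sets_def)
  have "\<rho> |` local_atoms M i \<in> LSD M i" if "i \<in> V" for i
  proof -
    have "local_atoms M i \<subseteq> dom \<pi>" using \<pi> that by (auto simp: glued_def)
    then show ?thesis using \<pi> that by (simp add: \<rho> restrict_add_left[OF ag] glued_def)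
  qed
  moreover have "\<rho> |` local_atoms M i \<in> LSD M i" if "i \<in> W" for i
  proof -
    have "local_atoms M i \<subseteq> dom \<sigma>" using \<sigma> that by (auto simp: glued_def)
    then show ?thesis using \<sigma> that by (simp add: \<rho> restrict_add_right glued_def)
  qed
  moreover have "dom \<rho> = (\<Union>i\<in>V \<union> W. local_atoms M i)"
    using \<pi> \<sigma> by (auto simp: \<rho> glued_def)
  ultimately show "\<rho> \<in> glued M (V \<union> W)" by (auto simp: glued_def)
next
  fix \<rho> assume \<rho>: "\<rho> \<in> glued M (V \<union> W)"
  \<comment> \<open>\<open>A U\<close> is the common domain of the maps in \<open>glued M U\<close>.
    The two joined maps are the restrictions of \<open>\<rho>\<close> to such domains, and
    restrictions of one map agree.\<close>
  define A where "A U = (\<Union>i\<in>U. local_atoms M i)" for U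
  have restr: "\<rho> |` A U \<in> glued M U" if "U \<subseteq> V \<union> W" for U
  proof -
    have "A U \<inter> local_atoms M i = local_atoms M i" if "i \<in> U" for i
      using that by (auto simp: A_def)
    moreover have "dom \<rho> \<inter> A U = A U" using \<rho> that by (auto simp: glued_def A_def)
    ultimately show ?thesis using \<rho> that by (auto simp: glued_def A_def)
  qed
  have "\<rho> x = (\<rho> |` A V ++ \<rho> |` A W) x" for x
  proof (cases "x \<in> A V \<union> A W")
    case True
    then show ?thesis by (cases "\<rho> x") (auto simp: map_add_def restrict_map_def)
  next
    case False
    then have "x \<notin> dom \<rho>" using \<rho> by (auto simp: glued_def A_def)
    then show ?thesis using False by (auto simp: map_add_def)
  qed
  then have "\<rho> = \<rho> |` A V ++ \<rho> |` A W" by blast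
  moreover have "agree (\<rho> |` A V) (\<rho> |` A W)" by (auto simp: agree_def)
  ultimately show "\<rho> \<in> glued M V \<bowtie> glued M W"
    unfolding join_sets_def using restr[of V] restr[of W] by blast
qed

section \<open>Contexts reachable outside the history\<close>

text \<open>\<open>H\<close> blocks only contexts entered after the start: \<open>k\<close> belongs
  to the set even if it lies in \<open>H\<close>, as a call always contributes its own local
  symmetries.\<close>

inductive_set reach :: "('a, 'kb) mcs \<Rightarrow> nat set \<Rightarrow> nat \<Rightarrow> nat set"
  for M :: "('a, 'kb) mcs" and H :: "nat set" and k :: nat where
  self: "k \<in> reach M H k"
| step: "i \<in> reach M H k \<Longrightarrow> j \<in> import_nbh M i \<Longrightarrow> j \<notin> H \<Longrightarrow> j \<in> reach M H k"

lemma reach_empty: "reach M {} k = import_closure M k"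
proof (intro set_eqI iffI)
  show "x \<in> import_closure M k" if "x \<in> reach M {} k" for x
    using that by induction (auto intro: import_closure.intros)
  show "x \<in> reach M {} k" if "x \<in> import_closure M k" for x
    using that by induction (auto intro: reach.intros)
qed

text \<open>Returning to \<open>k\<close> reaches nothing new, so the search may avoid \<open>k\<close> after the first step.\<close>

lemma reach_unfold:
  "reach M H k = {k} \<union> (\<Union>i\<in>import_nbh M k - (H \<union> {k}). reach M (H \<union> {k}) i)"
  (is "_ = ?R")
proof (intro set_eqI iffI)
  show "x \<in> ?R" if "x \<in> reach M H k" for x
    using that
  proof induction
    case (step i j)
    then show ?case
      \<comment> \<open>If \<open>i = k\<close>, then \<open>j\<close> is a neighbour that starts
        its own search; if neither is \<open>k\<close>, then \<open>j\<close> extends the search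
        that found \<open>i\<close>.\<close>
      by (cases "j = k"; cases "i = k") (auto intro: reach.intros)
  qed simp
next
  have "x \<in> reach M H k"
    if "x \<in> reach M (H \<union> {k}) i" "i \<in> import_nbh M k - (H \<union> {k})" for x i
    using that by induction (auto intro: reach.intros)
  then show "x \<in> reach M H k" if "x \<in> ?R" for x
    using that by (auto intro: reach.self)
qed

section \<open>The value returned by a call\<close>

text \<open>In the loop, \<open>V\<close> stands for the contexts collected so far; each iteration
  enlarges it by the contexts that the called neighbour reaches. Caches hold only local symmetries,
  never joins, so earlier calls do not influence the result.\<close>

lemma DSD_glued:
  "DSD M k H c \<Pi> c' \<Longrightarrow> valid_cache M c \<Longrightarrow> \<Pi> = glued M (reach M H k) \<and> valid_cache M c'"
  "DSD_loop M H is \<Pi> c \<Pi>' c' \<Longrightarrow> valid_cache M c \<Longrightarrow>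
     (\<forall>V. \<Pi> = glued M V \<longrightarrow> \<Pi>' = glued M (V \<union> (\<Union>i\<in>set is. reach M H i))) \<and> valid_cache M c'"
proof (induction rule: DSD_DSD_loop.inducts)
  case (call c\<^sub>1 c k H\<^sub>1 H "is" \<Pi> c\<^sub>2)
  have c\<^sub>1: "c\<^sub>1 = (if c k = None then c(k \<mapsto> LSD M k) else c)" by fact
  have c: "c j = None \<or> c j = Some (LSD M j)" for j
    using call.prems by (simp add: valid_cache_def)
  have valid: "valid_cache M c\<^sub>1" using c by (simp add: c\<^sub>1 valid_cache_def)
  have "the (c\<^sub>1 k) = LSD M k" using c[of k] by (auto simp: c\<^sub>1)
  then have "the (c\<^sub>1 k) = glued M {k}" by (simp add: glued_singleton)
  then have "\<Pi> = glued M ({k} \<union> (\<Union>i\<in>set is. reach M H\<^sub>1 i))" and "valid_cache M c\<^sub>2"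
    using call.IH(4)[OF valid] by blast+
  then show ?case using call reach_unfold[of M H k] by simp
next
  case (loop_step i H c \<Sigma> c\<^sub>1 "is" \<Pi> \<Pi>' c\<^sub>2)
  then show ?case by (auto simp: glued_join Un_assoc)
qed auto

section \<open>Index bounds and termination\<close>

lemma import_nbh_less:
  "is_mcs M \<Longrightarrow> k < length M \<Longrightarrow> import_nbh M k \<subseteq> {..<length M}"
  by (fastforce simp: is_mcs_def import_nbh_def)

lemma import_closure_less:
  assumes "is_mcs M" "k < length M"
  shows "import_closure M k \<subseteq> {..<length M}"
proof
  show "x \<in> {..<length M}" if "x \<in> import_closure M k" for x
    using that by induction (use assms import_nbh_less in fastforce)+
qed

text \<open>The hypothesis covers all caches, because each iteration starts with those left by the
  previous one.\<close>

lemma DSD_loop_terminates: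
  assumes "\<And>i c. i \<in> set is \<Longrightarrow> \<exists>\<Sigma> c'. DSD M i H c \<Sigma> c'"
  shows "\<exists>\<Pi>' c'. DSD_loop M H is \<Pi> c \<Pi>' c'"
  using assms
proof (induction "is" arbitrary: \<Pi> c)
  case Nil
  show ?case by (blast intro: loop_done)
next
  case (Cons i "is")
  then obtain \<Sigma> c\<^sub>1 where "DSD M i H c \<Sigma> c\<^sub>1" by (meson list.set_intros(1))
  moreover have "\<exists>\<Pi>' c'. DSD_loop M H is (\<Pi> \<bowtie> \<Sigma>) c\<^sub>1 \<Pi>' c'"
    using Cons.prems by (intro Cons.IH) auto
  ultimately show ?case by (blast intro: loop_step)
qed

text \<open>Every nested call has one more context in its history, so the number of unvisited
  contexts decreases.\<close>

lemma DSD_terminates: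
  assumes "is_mcs M" "k < length M" "k \<notin> H"
  shows "\<exists>\<Pi> c'. DSD M k H c \<Pi> c'"
  using assms(2,3)
proof (induction "card ({..<length M} - H)" arbitrary: k H c rule: less_induct)
  case less
  have nbh: "import_nbh M k \<subseteq> {..<length M}" using assms(1) less.prems import_nbh_less by blast
  \<comment> \<open>\<open>br M k\<close> may be infinite, but it refers to finitely many contexts,
    so the loop has a list to run over.\<close>
  then have "finite (import_nbh M k - (H \<union> {k}))" by (meson finite_Diff finite_lessThan finite_subset)
  then obtain "is" where "is": "set is = import_nbh M k - (H \<union> {k})" "distinct is"
    using finite_distinct_list by blast
  have card: "card ({..<length M} - (H \<union> {k})) < card ({..<length M} - H)"
    using less.prems by (intro psubset_card_mono) auto
  have "\<exists>\<Sigma> c'. DSD M i (H \<union> {k}) c'' \<Sigma> c'" if "i \<in> set is" for i c''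
    using that "is"(1) nbh by (intro less.hyps[OF card]) auto
  then show ?case
    using DSD_loop_terminates[of "is"] call[OF refl refl "is"] by meson
qed

section \<open>Bridge atoms, renaming and restriction\<close>

lemma set_bridge_rule_eq: "set_bridge_rule r = insert (head r) (snd ` body r)"
proof (cases r)
  case (Rule a P N)
  then show ?thesis by (force simp: body_def image_iff snds.simps)
qed

lemma at_subset:
  assumes "is_mcs M" "i < length M"
  shows "at (br M i) \<subseteq> (\<Union>c\<in>insert i (import_nbh M i). alph M c)"
proof
  fix x assume "x \<in> at (br M i)"
  then obtain r where r: "r \<in> br M i" and "x \<in> insert (head r) (snd ` body r)"
    by (auto simp: at_def set_bridge_rule_eq)
  then consider "x = head r" | c where "(c, x) \<in> body r" by force
  then show "x \<in> (\<Union>c\<in>insert i (import_nbh M i). alph M c)"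
    using assms r by cases (fastforce simp: is_mcs_def import_nbh_def)+
qed

lemma at_map_bridge_rule: "at (map_bridge_rule f ` R) = f ` at R"
  by (auto simp: at_def bridge_rule.set_map)

lemma map_bridge_rule_cong_at:
  assumes "\<And>a. a \<in> at R \<Longrightarrow> f a = g a"
  shows "map_bridge_rule f ` R = map_bridge_rule g ` R"
  using assms by (intro image_cong refl bridge_rule.map_cong0) (auto simp: at_def)

lemma local_atoms_subset_full:
  assumes "is_mcs M" "i < length M"
  shows "local_atoms M i \<subseteq> full_alphabet M"
  using at_subset[OF assms] import_nbh_less[OF assms] assms(2)
  unfolding local_atoms_def full_alphabet_def by blast

text \<open>\<open>is_logic\<close> constrains \<open>ren\<close> only on permutations of the
  alphabet, so bijectivity is first transferred from \<open>f\<close> to \<open>g\<close>.\<close>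

lemma ren_cong:
  assumes L: "is_logic L" "x \<in> KB L" and bij: "bij_betw f (alphabet L) (alphabet L)"
    and eq: "\<And>a. a \<in> alphabet L \<Longrightarrow> f a = g a"
  shows "ren L f x = ren L g x"
proof -
  have "bij_betw g (alphabet L) (alphabet L)" using bij eq by (metis bij_betw_cong)
  moreover have "\<forall>f g. bij_betw f (alphabet L) (alphabet L) \<and> bij_betw g (alphabet L) (alphabet L) \<longrightarrow>
      ren L (f \<circ> g) x = ren L f (ren L g x) \<and>
      ((\<forall>a \<in> alphabet L. f a = g a) \<longrightarrow> ren L f x = ren L g x)"
    using L unfolding is_logic_def by (elim conjE) (drule (1) bspec, elim conjE)
  ultimately have "(\<forall>a \<in> alphabet L. f a = g a) \<longrightarrow> ren L f x = ren L g x"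
    using bij by iprover
  then show ?thesis using eq by blast
qed

text \<open>
  That \<open>\<pi>\<close> maps \<open>local_atoms M i\<close> onto itself needs no separate condition, because it preserves both
  \<open>alph M i\<close> and the bridge rules.
\<close>

lemma restrict_in_LSD_iff:
  assumes M: "is_mcs M" "i < length M" and dom: "local_atoms M i \<subseteq> dom \<pi>"
  shows "\<pi> |` local_atoms M i \<in> LSD M i \<longleftrightarrow>
    inj_on (the \<circ> \<pi>) (local_atoms M i) \<and>
    (the \<circ> \<pi>) ` alph M i = alph M i \<and>
    ren (logic_of (M ! i)) (the \<circ> \<pi>) (kb M i) = kb M i \<and>
    map_bridge_rule (the \<circ> \<pi>) ` br M i = br M i"
proof -
  let ?S = "local_atoms M i" and ?f = "the \<circ> \<pi>" and ?g = "the \<circ> (\<pi> |` local_atoms M i)"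
  have eq: "?g a = ?f a" if "a \<in> ?S" for a using that by simp
  have img: "?g ` T = ?f ` T" if "T \<subseteq> ?S" for T using that eq by (intro image_cong) auto
  have inj: "inj_on ?g T \<longleftrightarrow> inj_on ?f T" if "T \<subseteq> ?S" for T
    using that eq by (intro inj_on_cong) auto
  have alph: "alph M i \<subseteq> ?S" and at: "at (br M i) \<subseteq> ?S" by (auto simp: local_atoms_def)
  have br: "map_bridge_rule ?g ` br M i = map_bridge_rule ?f ` br M i"
    using at eq by (intro map_bridge_rule_cong_at) auto
  \<comment> \<open>The renamings are comparable only if \<open>?f\<close> permutes the alphabet.
    Both sides of the equivalence supply the two conditions for this.\<close>
  have ren: "ren (logic_of (M ! i)) ?g (kb M i) = ren (logic_of (M ! i)) ?f (kb M i)"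
    if "inj_on ?f ?S" "?f ` alph M i = alph M i"
    using that alph eq img[OF alph] inj[OF alph] M
    by (intro ren_cong) (auto simp: is_mcs_def bij_betw_def intro: inj_on_subset)
  have surj: "?f ` ?S = ?S" if "?f ` alph M i = alph M i" "map_bridge_rule ?f ` br M i = br M i"
    using that at_map_bridge_rule[of ?f "br M i"] by (simp add: local_atoms_def image_Un)
  have "dom \<pi> \<inter> ?S = ?S" using dom by blast
  then have "\<pi> |` ?S \<in> LSD M i \<longleftrightarrow>
      inj_on ?f ?S \<and> ?f ` ?S = ?S \<and> ?f ` alph M i = alph M i \<and>
      ren (logic_of (M ! i)) ?g (kb M i) = kb M i \<and> map_bridge_rule ?f ` br M i = br M i"
    using local_atoms_subset_full[OF M] img[OF order.refl] inj[OF order.refl] img[OF alph] br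
    unfolding LSD_def partial_symmetry_def permutation_of_def bij_betw_def
    by (simp add: local_atoms_def[symmetric] del: o_apply)
  then show ?thesis using ren surj by auto
qed

section \<open>Glued maps over import-closed sets\<close>

lemma glued_iff_partial_symmetry:
  assumes M: "is_mcs M" and V: "V \<subseteq> {..<length M}"
    and closed: "\<And>i. i \<in> V \<Longrightarrow> import_nbh M i \<subseteq> V"
  shows "\<pi> \<in> glued M V \<longleftrightarrow> partial_symmetry M (\<Union>i\<in>V. local_atoms M i) V \<pi>"
proof
  let ?S = "\<Union>i\<in>V. local_atoms M i" and ?f = "the \<circ> \<pi>"
  \<comment> \<open>Body atoms lie in alphabets of imported contexts, which \<open>closed\<close>
    places in \<open>V\<close> again.\<close>
  have atoms: "?S = (\<Union>i\<in>V. alph M i)"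
  proof
    have "at (br M i) \<subseteq> (\<Union>i\<in>V. alph M i)" if "i \<in> V" for i
      using at_subset[OF M, of i] closed[OF that] V that by blast
    then show "?S \<subseteq> (\<Union>i\<in>V. alph M i)" by (auto simp: local_atoms_def)
  qed (auto simp: local_atoms_def)
  {
    assume \<pi>: "\<pi> \<in> glued M V"
    then have dom: "dom \<pi> = ?S" by (simp add: glued_def)
    have sym: "inj_on ?f (local_atoms M i)" "?f ` alph M i = alph M i"
      "ren (logic_of (M ! i)) ?f (kb M i) = kb M i" "map_bridge_rule ?f ` br M i = br M i"
      if "i \<in> V" for i
    proof -
      have "i < length M" "local_atoms M i \<subseteq> dom \<pi>" using that V dom by auto
      from restrict_in_LSD_iff[OF M this] that \<pi>
      show "inj_on ?f (local_atoms M i)" "?f ` alph M i = alph M i"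
        "ren (logic_of (M ! i)) ?f (kb M i) = kb M i" "map_bridge_rule ?f ` br M i = br M i"
        by (auto simp: glued_def)
    qed
    \<comment> \<open>Atoms with equal images come from the same alphabet, since distinct alphabets
      are disjoint and each is mapped onto itself; there local injectivity applies.\<close>
    have "inj_on ?f (\<Union>i\<in>V. alph M i)"
    proof (rule inj_onI)
      fix x y assume "x \<in> (\<Union>i\<in>V. alph M i)" "y \<in> (\<Union>i\<in>V. alph M i)" and eq: "?f x = ?f y"
      then obtain i j where ij: "i \<in> V" "j \<in> V" "x \<in> alph M i" "y \<in> alph M j" by blast
      then have "?f x \<in> alph M i" "?f y \<in> alph M j"
        using sym(2)[OF \<open>i \<in> V\<close>] sym(2)[OF \<open>j \<in> V\<close>] by blast+
      moreover have "alph M i \<inter> alph M j = {}" if "i \<noteq> j"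
        using M V ij(1,2) that unfolding is_mcs_def by blast
      ultimately have "i = j" using eq by fastforce
      then show "x = y" using sym(1)[OF ij(1)] ij eq by (auto simp: local_atoms_def inj_on_def)
    qed
    moreover have "?f ` (\<Union>i\<in>V. alph M i) = (\<Union>i\<in>V. alph M i)"
      unfolding image_UN using sym(2) by (intro SUP_cong refl) auto
    ultimately have "permutation_of ?S \<pi>"
      using dom by (simp add: permutation_of_def bij_betw_def atoms del: o_apply)
    moreover have "?S \<subseteq> full_alphabet M" using V by (auto simp: atoms full_alphabet_def)
    moreover have "\<forall>i\<in>V. alph M i \<union> at (br M i) \<subseteq> ?S" by (auto simp: local_atoms_def)
    ultimately show "partial_symmetry M ?S V \<pi>"
      using sym(2-4) by (simp add: partial_symmetry_def del: o_apply)
  }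
  {
    assume \<pi>: "partial_symmetry M ?S V \<pi>"
    then have dom: "dom \<pi> = ?S" and inj: "inj_on ?f ?S"
      by (auto simp: partial_symmetry_def permutation_of_def bij_betw_def)
    have "\<pi> |` local_atoms M i \<in> LSD M i" if "i \<in> V" for i
    proof -
      have "i < length M" "local_atoms M i \<subseteq> dom \<pi>" "inj_on ?f (local_atoms M i)"
        using that V dom inj by (auto intro: inj_on_subset)
      then show ?thesis
        using restrict_in_LSD_iff[OF M, of i \<pi>] \<pi> that by (simp add: partial_symmetry_def)
    qed
    then show "\<pi> \<in> glued M V" using dom by (simp add: glued_def)
  }
qed

theorem theorem2:
  fixes M :: "('a, 'kb) mcs" and k :: nat and c :: "'a cache"
  assumes "is_mcs M"
    and "k < length M"
    and "valid_cache M c"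
  shows "(\<exists>\<Pi> c'. DSD M k {} c \<Pi> c') \<and>
    (\<forall>\<Pi> c'. DSD M k {} c \<Pi> c' \<longrightarrow>
       (\<forall>\<pi>. \<pi> \<in> \<Pi> \<longleftrightarrow>
          partial_symmetry M (\<Union>i \<in> import_closure M k. alph M i \<union> at (br M i))
            (import_closure M k) \<pi>))"
proof (intro conjI allI impI)
  show "\<exists>\<Pi> c'. DSD M k {} c \<Pi> c'" using DSD_terminates assms(1,2) by blast
next
  fix \<Pi> c' \<pi> assume "DSD M k {} c \<Pi> c'"
  \<comment> \<open>The empty history blocks nothing, so the search covers the whole import
    closure.\<close>
  then have "\<Pi> = glued M (import_closure M k)"
    using DSD_glued(1) assms(3) reach_empty by metis
  moreover have "import_nbh M i \<subseteq> import_closure M k" if "i \<in> import_closure M k" for i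
    using that by (blast intro: import_closure.step)
  ultimately show "\<pi> \<in> \<Pi> \<longleftrightarrow>
      partial_symmetry M (\<Union>i \<in> import_closure M k. alph M i \<union> at (br M i)) (import_closure M k) \<pi>"
    using glued_iff_partial_symmetry[OF assms(1) import_closure_less[OF assms(1,2)]]
    by (simp add: local_atoms_def)
qed

end
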